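(* Any exact context-independent compositional summary of a separator $C$ of size $\Theta(w)$ that preserves reachability under arbitrary external contexts requires $$2^{\Omega(w^2)}$$ distinguishable states in the worst case (asymptotically as $w\to\infty$).
   Context: Let $C$ be a finite set of vertices (the separator). A component with interface $C$ is a finite directed graph $H$ with $C\subseteq V(H)$ (a deterministic component, i.e. all of whose edges are live with probability $1$). An external context for $C$ is a finite directed graph $D$ with $C\subseteq V(D)$; attaching $H$ to $D$ means forming the union $H\cup D$ after making $V(H)\setminus C$ and $V(D)\setminus C$ disjoint, so that $H$ and $D$ meet only in $C$. Write $a\rightsquigarrow b$ if there is a directed path from $a$ to $b$. A context-independent compositional summary of $C$ is a map $s$ assigning to each component $H$ with interface $C$ a state $s(H)$ in some set $Q$, where $s(H)$ depends only on $H$ and not on the external context. It is exact (preserves reachability under arbitrary external contexts) if the reachability answers after attaching $H$ to a context depend on $H$ only through $s(H)$: whenever $s(H)=s(H')$, then for every external context $D$ and all $a,b\in V(D)$, $a\rightsquigarrow b$ holds in $H\cup D$ if and only if it holds in $H'\cup D$. The number of distinguishable states is the number of distinct values taken by $s$. *)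

theory Defs
  imports "Graph_Theory.Pair_Digraph" "HOL-Library.Landau_Symbols" Complex_Main
begin

text \<open>
  Both the components with interface \<open>C\<close> and the external contexts for \<open>C\<close> are the finite
  directed graphs whose vertex set contains \<open>C\<close>.
\<close>

definition components :: "'v set \<Rightarrow> 'v pair_pre_digraph set" where
  "components C = {H. pair_fin_digraph H \<and> C \<subseteq> pverts H}"

definition contexts :: "'v set \<Rightarrow> 'v pair_pre_digraph set" where
  "contexts C = {D. pair_fin_digraph D \<and> C \<subseteq> pverts D}"

text \<open>
  The sum type makes \<open>V(H) - C\<close> and \<open>V(D) - C\<close> disjoint: the vertices of the context \<open>D\<close>,
  including those of \<open>C\<close>, are tagged \<open>Inl\<close>; the vertices of \<open>H\<close> outside \<open>C\<close> are tagged \<open>Inr\<close>.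
\<close>

definition tag :: "'v set \<Rightarrow> 'v \<Rightarrow> 'v + 'v" where
  "tag C v = (if v \<in> C then Inl v else Inr v)"

definition attach :: "'v set \<Rightarrow> 'v pair_pre_digraph \<Rightarrow> 'v pair_pre_digraph \<Rightarrow> ('v + 'v) pair_pre_digraph"
  where
  "attach C H D =
     \<lparr> pverts = tag C ` pverts H \<union> Inl ` pverts D,
       parcs = map_prod (tag C) (tag C) ` parcs H \<union> map_prod Inl Inl ` parcs D \<rparr>"

text \<open>
  A summary is an arbitrary function of the component alone, so it is context-independent by
  its type. Its values outside \<open>components C\<close> are irrelevant.
\<close>

definition exact_summary :: "'v set \<Rightarrow> ('v pair_pre_digraph \<Rightarrow> 'q) \<Rightarrow> bool" where
  "exact_summary C s \<longleftrightarrow>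
     (\<forall>H \<in> components C. \<forall>H' \<in> components C. s H = s H' \<longrightarrow>
       (\<forall>D \<in> contexts C. \<forall>a \<in> pverts D. \<forall>b \<in> pverts D.
          Inl a \<rightarrow>\<^sup>*\<^bsub>with_proj (attach C H D)\<^esub> Inl b \<longleftrightarrow>
          Inl a \<rightarrow>\<^sup>*\<^bsub>with_proj (attach C H' D)\<^esub> Inl b))"

definition states :: "'v set \<Rightarrow> ('v pair_pre_digraph \<Rightarrow> 'q) \<Rightarrow> 'q set" where
  "states C s = s ` components C"

end

theory Submission
  imports Defs
begin

text \<open>
  Split \<open>C\<close> into two halves \<open>A\<close> and \<open>B\<close>. In a bipartite graph with all arcs from \<open>A\<close> to \<open>B\<close>, no
  two arcs compose, so its arcs are exactly the reachable pairs in \<open>A \<times> B\<close>, which the arcless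
  context on \<open>C\<close> already reveals. Hence the \<open>2 ^ (card A * card B)\<close> bipartite graphs have
  pairwise distinct states.
\<close>

lemma rtrancl_bipartite:
  assumes "E \<subseteq> A \<times> B" "A \<inter> B = {}"
  shows "E\<^sup>* = Id \<union> E"
proof -
  have "E O E = {}" using assms by blast
  then have "trans E" by (auto intro!: transI)
  then show ?thesis by (simp add: rtrancl_trancl_reflcl trancl_id Un_commute)
qed

text \<open>One shape serves for both sides: with arcs it is a component, without arcs the probing
  context. Having no vertices outside \<open>C\<close>, it never produces \<open>Inr\<close>
  vertices when attached.\<close>

definition graph_on :: "'v set \<Rightarrow> ('v \<times> 'v) set \<Rightarrow> 'v pair_pre_digraph" where
  "graph_on C E = \<lparr> pverts = C, parcs = E \<rparr>"

lemma graph_on_component: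
  assumes "finite C" "E \<subseteq> C \<times> C"
  shows "graph_on C E \<in> components C"
proof -
  have "finite E" using assms by (meson finite_SigmaI finite_subset)
  with assms show ?thesis
    by (auto simp: components_def graph_on_def intro!: pair_fin_digraph.intro
        pair_wf_digraph.intro pair_fin_digraph_axioms.intro)
qed

lemma arcless_context: "finite C \<Longrightarrow> graph_on C {} \<in> contexts C"
  using graph_on_component[of C "{}"] by (simp add: components_def contexts_def)

text \<open>\<open>tag C\<close> acts as \<open>Inl\<close> on all of \<open>C\<close>, so attaching
  to the arcless context merely yields an \<open>Inl\<close>-copy of \<open>E\<close>, whose closure
  adds only the diagonal.\<close>

lemma reachable_bipartite_iff:
  assumes "E \<subseteq> A \<times> B" "A \<inter> B = {}" "A \<union> B \<subseteq> C" "a \<in> A" "b \<in> B"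
  shows "Inl a \<rightarrow>\<^sup>*\<^bsub>with_proj (attach C (graph_on C E) (graph_on C {}))\<^esub> Inl b \<longleftrightarrow> (a, b) \<in> E"
proof -
  let ?G = "attach C (graph_on C E) (graph_on C {})"
  let ?E = "map_prod Inl Inl ` E :: ('a + 'a) rel"
  have "map_prod (tag C) (tag C) ` E = ?E"
    using assms(1,3) by (intro image_cong) (auto simp: tag_def dest!: subsetD)
  then have arcs: "parcs ?G = ?E" by (simp add: attach_def graph_on_def)
  have verts: "pverts ?G = Inl ` C" by (auto simp: attach_def graph_on_def tag_def)
  have ends: "arcs_ends (with_proj ?G) = ?E"
    by (auto simp: arcs_ends_def arc_to_ends_def arcs)
  have "?E \<subseteq> Inl ` A \<times> Inl ` B" using assms(1) by auto
  then have closure: "?E\<^sup>* = Id \<union> ?E"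
    using assms(2) by (intro rtrancl_bipartite[of _ "Inl ` A" "Inl ` B"]) auto
  \<comment> \<open>This excludes the \<open>Id\<close> part of the closure.\<close>
  have "a \<noteq> b" using assms by auto
  show ?thesis
  proof
    assume "Inl a \<rightarrow>\<^sup>*\<^bsub>with_proj ?G\<^esub> Inl b"
    then have "(Inl a, Inl b) \<in> ?E\<^sup>*"
      unfolding reachable_def ends by (rule rtrancl_on_rtranclI)
    then show "(a, b) \<in> E" using closure \<open>a \<noteq> b\<close> by auto
  next
    assume "(a, b) \<in> E"
    then have "(Inl a, Inl b) \<in> ?E" by force
    \<comment> \<open>\<open>reachable\<close> is a closure restricted to the vertex set, so both
      ends must be checked to be vertices; the converse direction only forgets this
      restriction.\<close>
    then show "Inl a \<rightarrow>\<^sup>*\<^bsub>with_proj ?G\<^esub> Inl b"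
      unfolding reachable_def ends using assms(3-5) verts
      by (intro rtrancl_on_into_rtrancl_on[OF rtrancl_on_refl]) auto
  qed
qed

lemma exact_summary_inj_on_bipartite:
  assumes s: "exact_summary C s" and "finite C" "A \<inter> B = {}" "A \<union> B \<subseteq> C"
  shows "inj_on (\<lambda>E. s (graph_on C E)) (Pow (A \<times> B))"
proof (rule inj_onI)
  fix E F assume E: "E \<in> Pow (A \<times> B)" and F: "F \<in> Pow (A \<times> B)"
    and eq: "s (graph_on C E) = s (graph_on C F)"
  have comp: "graph_on C E \<in> components C" "graph_on C F \<in> components C"
    using E F assms(2,4) by (auto intro!: graph_on_component)
  have "(a, b) \<in> E \<longleftrightarrow> (a, b) \<in> F" if "a \<in> A" "b \<in> B" for a b
  proof -
    have "a \<in> pverts (graph_on C {})" "b \<in> pverts (graph_on C {})"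
      using that assms(4) by (auto simp: graph_on_def)
    then have "Inl a \<rightarrow>\<^sup>*\<^bsub>with_proj (attach C (graph_on C E) (graph_on C {}))\<^esub> Inl b \<longleftrightarrow>
        Inl a \<rightarrow>\<^sup>*\<^bsub>with_proj (attach C (graph_on C F) (graph_on C {}))\<^esub> Inl b"
      using s comp eq arcless_context[OF assms(2)] unfolding exact_summary_def by blast
    then show ?thesis
      using reachable_bipartite_iff[OF _ assms(3,4) that] E F by simp
  qed
  then show "E = F" using E F by auto
qed

lemma card_states_ge:
  assumes "exact_summary C s" "finite C" "finite (states C s)"
  shows "2 ^ ((card C div 2)\<^sup>2) \<le> card (states C s)"
proof -
  let ?m = "card C div 2"
  obtain A where A: "A \<subseteq> C" "card A = ?m" "finite A"
    using obtain_subset_with_card_n[of ?m C] by auto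
  \<comment> \<open>Since 2 * \<open>?m\<close> \<le> \<open>card C\<close>, enough vertices remain
    for a disjoint \<open>B\<close>; for odd \<open>card C\<close> one vertex is left over and stays
    isolated.\<close>
  have "?m \<le> card (C - A)" using A by (simp add: card_Diff_subset)
  then obtain B where B: "B \<subseteq> C - A" "card B = ?m" "finite B"
    using obtain_subset_with_card_n by metis
  have inj: "inj_on (\<lambda>E. s (graph_on C E)) (Pow (A \<times> B))"
    using A B assms(1,2) by (intro exact_summary_inj_on_bipartite) auto
  have "(\<lambda>E. s (graph_on C E)) ` Pow (A \<times> B) \<subseteq> states C s"
    using A B assms(2) by (auto simp: states_def intro!: imageI graph_on_component)
  then have "card (Pow (A \<times> B)) \<le> card (states C s)"
    using card_inj_on_le[OF inj _ assms(3)] by blast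
  then show ?thesis
    using A B by (simp add: card_Pow card_cartesian_product power2_eq_square)
qed

theorem theorem3p6:
  fixes C :: "nat \<Rightarrow> 'v set"
  assumes "\<And>w. finite (C w)"
    and "(\<lambda>w. real (card (C w))) \<in> \<Theta>(\<lambda>w. real w)"
  shows "\<exists>c::real. c > 0 \<and>
    (\<forall>\<^sub>F w in sequentially. \<forall>s :: 'v pair_pre_digraph \<Rightarrow> 'q.
       exact_summary (C w) s \<longrightarrow>
         infinite (states (C w) s) \<or>
         2 powr (c * (real w)\<^sup>2) \<le> real (card (states (C w) s)))"
proof -
  have "(\<lambda>w. real (card (C w))) \<in> \<Omega>(\<lambda>w. real w)"
    using assms(2) by (rule bigthetaD2)
  then obtain k where k: "k > 0"
    and ev: "\<forall>\<^sub>F w in sequentially. norm (real (card (C w))) \<ge> k * norm (real w)"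
    by (rule landau_omega.bigE)
  \<comment> \<open>The threshold absorbs the rounding in \<open>div 2\<close>: from
    \<open>card (C w)\<close> \<ge> k w one gets \<open>card (C w) div 2\<close> \<ge> (k w - 1) /
    2, and this is at least k w / 4 once k w \<ge> 2. Squaring yields the constant
    \<open>(k / 4)\<^sup>2\<close>, which is the same for all summaries.\<close>
  have large: "\<forall>\<^sub>F w in sequentially. real w \<ge> 2 / k"
    using filterlim_real_sequentially by (simp add: filterlim_at_top)
  have "\<forall>\<^sub>F w in sequentially. \<forall>s :: 'v pair_pre_digraph \<Rightarrow> 'q.
       exact_summary (C w) s \<longrightarrow>
         infinite (states (C w) s) \<or>
         2 powr ((k / 4)\<^sup>2 * (real w)\<^sup>2) \<le> real (card (states (C w) s))"
    using ev large
  proof eventually_elim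
    case (elim w)
    let ?m = "card (C w) div 2"
    have "k * real w \<ge> 2" using elim(2) k by (simp add: field_simps)
    moreover have "real (card (C w)) \<le> 2 * real ?m + 1" by linarith
    ultimately have "k / 4 * real w \<le> real ?m" using elim(1) by simp
    then have "(k / 4 * real w)\<^sup>2 \<le> (real ?m)\<^sup>2" using k by (intro power_mono) auto
    then have "(k / 4)\<^sup>2 * (real w)\<^sup>2 \<le> real (?m\<^sup>2)"
      by (simp only: power_mult_distrib of_nat_power)
    then have "2 powr ((k / 4)\<^sup>2 * (real w)\<^sup>2) \<le> 2 powr real (?m\<^sup>2)"
      by (rule powr_mono) simp
    also have "\<dots> = 2 ^ (?m\<^sup>2)" by (rule powr_realpow) simp
    also have "\<dots> = real (2 ^ (?m\<^sup>2))" by (simp only: of_nat_power of_nat_numeral)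
    finally have bound: "2 powr ((k / 4)\<^sup>2 * (real w)\<^sup>2) \<le> real (2 ^ (?m\<^sup>2))" .
    show ?case
    proof (intro allI impI)
      fix s :: "'v pair_pre_digraph \<Rightarrow> 'q" assume s: "exact_summary (C w) s"
      \<comment> \<open>\<open>card\<close> is 0 on infinite sets, so counting is meaningful only
        for finitely many states; the other case is the first disjunct.\<close>
      have "real (2 ^ (?m\<^sup>2)) \<le> real (card (states (C w) s))" if "finite (states (C w) s)"
        using card_states_ge[OF s assms(1) that] by (rule of_nat_mono)
      with bound show "infinite (states (C w) s) \<or>
          2 powr ((k / 4)\<^sup>2 * (real w)\<^sup>2) \<le> real (card (states (C w) s))"
        by linarith
    qed
  qed
  then show ?thesis using k by (intro exI[of _ "(k / 4)\<^sup>2"]) simp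
qed

end
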